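(* For every tree $T$, the ray space $\mathcal{R}(T)$ is monotonically normal, and hence hereditarily normal.
   Context: A tree is a partially ordered set $T$ with a unique minimal element such that the set of predecessors of any element is well-ordered (distinct limit nodes may have the same set of strict predecessors). A path in $T$ is a nonempty down-closed chain; a ray is a path without maximal element. The ray space $\mathcal{R}(T)$ is the set of all rays of $T$ with the subspace topology inherited from $2^T$ (product topology), rays being identified with their characteristic functions. A topological space $X$ is monotonically normal if to each pair $\langle U,x\rangle$, where $U\subseteq X$ is open and $x\in U$, one can assign an open set $U_x$ with $x\in U_x\subseteq U$ such that for any two such pairs $\langle U,x\rangle$, $\langle V,y\rangle$: $U_x\cap V_y\neq\emptyset$ implies $x\in V$ or $y\in U$. *)

theory Defs
  imports "HOL-Analysis.Analysis"
begin

text \<open>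
  The pair \<open>(T, r)\<close> is the poset with carrier \<open>T\<close> and reflexive order \<open>r\<close>. A unique
  minimal element is required, so \<open>T\<close> is nonempty; the tree need not be Hausdorff, that is,
  \<open>underS r s = underS r t\<close> is allowed for distinct nodes \<open>s\<close>, \<open>t\<close> of limit height.
\<close>

definition order_tree :: "'a set \<Rightarrow> 'a rel \<Rightarrow> bool"
  where "order_tree T r \<longleftrightarrow>
    partial_order_on T r \<and>
    (\<exists>!m. m \<in> T \<and> underS r m = {}) \<and>
    (\<forall>t\<in>T. well_order_on (underS r t) (r \<inter> underS r t \<times> underS r t))"

definition tree_path :: "'a set \<Rightarrow> 'a rel \<Rightarrow> 'a set \<Rightarrow> bool"
  where "tree_path T r p \<longleftrightarrow>
    p \<subseteq> T \<and> p \<noteq> {} \<and> p \<in> Chains r \<and>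
    (\<forall>t\<in>p. \<forall>s\<in>T. (s, t) \<in> r \<longrightarrow> s \<in> p)"

definition tree_ray :: "'a set \<Rightarrow> 'a rel \<Rightarrow> 'a set \<Rightarrow> bool"
  where "tree_ray T r p \<longleftrightarrow>
    tree_path T r p \<and> \<not> (\<exists>m\<in>p. \<forall>t\<in>p. (m, t) \<in> r \<longrightarrow> t = m)"

text \<open>
  The points of the library's \<open>product_topology\<close> over \<open>T\<close> are functions that are
  \<open>undefined\<close> outside \<open>T\<close>, hence the restriction of characteristic functions to \<open>T\<close>.
\<close>

definition char_fun :: "'a set \<Rightarrow> 'a set \<Rightarrow> 'a \<Rightarrow> bool"
  where "char_fun T p = (\<lambda>t\<in>T. t \<in> p)"

definition ray_space :: "'a set \<Rightarrow> 'a rel \<Rightarrow> ('a \<Rightarrow> bool) topology"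
  where "ray_space T r =
    subtopology (product_topology (\<lambda>_. discrete_topology UNIV) T)
      (char_fun T ` {p. tree_ray T r p})"

text \<open>As in the definition followed here, no separation axiom such as \<open>T\<^sub>1\<close> is included.\<close>

definition monotonically_normal_space :: "'a topology \<Rightarrow> bool"
  where "monotonically_normal_space X \<longleftrightarrow>
    (\<exists>N :: 'a set \<Rightarrow> 'a \<Rightarrow> 'a set.
      (\<forall>U x. openin X U \<and> x \<in> U \<longrightarrow>
        openin X (N U x) \<and> x \<in> N U x \<and> N U x \<subseteq> U) \<and>
      (\<forall>U x V y. openin X U \<and> x \<in> U \<and> openin X V \<and> y \<in> V \<and>
        N U x \<inter> N V y \<noteq> {} \<longrightarrow> x \<in> V \<or> y \<in> U))"

end

theory Submission
  imports Defs
begin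

text \<open>
  Given an open neighbourhood \<open>U\<close> of a ray \<open>x\<close>, put \<open>N U x = [t; F]\<close>, the set of rays that contain
  \<open>t\<close> and miss \<open>F\<close>, where \<open>t \<in> x\<close>, \<open>F\<close> is a finite set of tops of \<open>x\<close> (nodes whose set of strict
  predecessors is \<open>x\<close>), and \<open>[t; F] \<subseteq> U\<close>. Suppose a ray \<open>z\<close> lies in both \<open>[t; F]\<close> and \<open>[s; G]\<close>,
  chosen for \<open>(U, x)\<close> and \<open>(V, y)\<close>, and say \<open>t \<le> s\<close>. Then \<open>t \<in> y\<close>, so if \<open>y \<notin> U\<close> then \<open>y\<close> contains
  some \<open>f \<in> F\<close>. As \<open>s \<in> z\<close> and \<open>f \<notin> z\<close>, the node \<open>s \<in> y\<close> lies strictly below \<open>f\<close>, whence \<open>s \<in> x\<close>;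
  and \<open>x \<subseteq> y\<close> misses \<open>G\<close>. Thus \<open>x \<in> V\<close>.
\<close>

section \<open>Monotonically normal spaces\<close>

text \<open>Extend each open set of the subspace to a chosen open set \<open>E U\<close> of
  \<open>X\<close> and take the trace of the old operator. Since \<open>x\<close> and
  \<open>y\<close> lie in \<open>S\<close>, membership in \<open>E V\<close> or \<open>E U\<close>
  falls back to \<open>V\<close> or \<open>U\<close>.\<close>

lemma monotonically_normal_space_subtopology:
  assumes "monotonically_normal_space X"
  shows "monotonically_normal_space (subtopology X S)"
proof -
  obtain N where N: "\<And>U x. \<lbrakk>openin X U; x \<in> U\<rbrakk> \<Longrightarrow> openin X (N U x) \<and> x \<in> N U x \<and> N U x \<subseteq> U"
    and NN: "\<And>U x V y. \<lbrakk>openin X U; x \<in> U; openin X V; y \<in> V; N U x \<inter> N V y \<noteq> {}\<rbrakk>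
      \<Longrightarrow> x \<in> V \<or> y \<in> U"
    using assms unfolding monotonically_normal_space_def by metis
  have "\<forall>U. \<exists>W. openin (subtopology X S) U \<longrightarrow> openin X W \<and> U = W \<inter> S"
    by (auto simp: openin_subtopology)
  then obtain E where E: "\<And>U. openin (subtopology X S) U \<Longrightarrow> openin X (E U) \<and> U = E U \<inter> S"
    by metis
  show ?thesis
    unfolding monotonically_normal_space_def
  proof (intro exI[of _ "\<lambda>U x. N (E U) x \<inter> S"] conjI allI impI; (elim conjE)?)
    fix U x assume U: "openin (subtopology X S) U" and x: "x \<in> U"
    from E[OF U] x have "openin X (E U)" "x \<in> E U" "x \<in> S" by auto
    note * = this N[OF this(1,2)]
    show "openin (subtopology X S) (N (E U) x \<inter> S)" using * by (auto simp: openin_subtopology)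
    show "x \<in> N (E U) x \<inter> S" using * by auto
    show "N (E U) x \<inter> S \<subseteq> U" using * E[OF U] by auto
  next
    fix U x V y
    assume "openin (subtopology X S) U" "x \<in> U" "openin (subtopology X S) V" "y \<in> V"
      "N (E U) x \<inter> S \<inter> (N (E V) y \<inter> S) \<noteq> {}"
    then show "x \<in> V \<or> y \<in> U"
      using E[of U] E[of V] NN[of "E U" x "E V" y] by blast
  qed
qed

text \<open>For disjoint closed \<open>A\<close> and \<open>B\<close>, shrink the complement of
  \<open>B\<close> around each point of \<open>A\<close> and the complement of \<open>A\<close>
  around each point of \<open>B\<close>. A point of \<open>A\<close> is never in the complement of
  \<open>A\<close>, nor one of \<open>B\<close> in that of \<open>B\<close>, so no two shrunken sets
  from different sides meet, and their unions separate.\<close>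

lemma monotonically_normal_imp_normal_space:
  assumes "monotonically_normal_space X"
  shows "normal_space X"
proof -
  obtain N where N: "\<And>U x. \<lbrakk>openin X U; x \<in> U\<rbrakk> \<Longrightarrow> openin X (N U x) \<and> x \<in> N U x \<and> N U x \<subseteq> U"
    and NN: "\<And>U x V y. \<lbrakk>openin X U; x \<in> U; openin X V; y \<in> V; N U x \<inter> N V y \<noteq> {}\<rbrakk>
      \<Longrightarrow> x \<in> V \<or> y \<in> U"
    using assms unfolding monotonically_normal_space_def by metis
  show ?thesis
    unfolding normal_space_def
  proof (intro allI impI, elim conjE)
    fix A B assume A: "closedin X A" and B: "closedin X B" and AB: "disjnt A B"
    define U where "U = topspace X - B"
    define V where "V = topspace X - A"
    have opn: "openin X U" "openin X V" using A B by (auto simp: U_def V_def)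
    have sub: "A \<subseteq> U" "B \<subseteq> V"
      using AB closedin_subset[OF A] closedin_subset[OF B] by (auto simp: U_def V_def disjnt_def)
    have "openin X (\<Union>a\<in>A. N U a)" "openin X (\<Union>b\<in>B. N V b)"
      using N opn sub by blast+
    moreover have "A \<subseteq> (\<Union>a\<in>A. N U a)" "B \<subseteq> (\<Union>b\<in>B. N V b)"
      using N opn sub by blast+
    moreover have "N U a \<inter> N V b = {}" if "a \<in> A" "b \<in> B" for a b
      using NN[of U a V b] opn sub that by (auto simp: U_def V_def)
    then have "disjnt (\<Union>a\<in>A. N U a) (\<Union>b\<in>B. N V b)"
      unfolding disjnt_def by blast
    ultimately show "\<exists>U V. openin X U \<and> openin X V \<and> A \<subseteq> U \<and> B \<subseteq> V \<and> disjnt U V"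
      by blast
  qed
qed

lemma monotonically_normal_imp_hereditarily_normal:
  "monotonically_normal_space X \<Longrightarrow> hereditarily normal_space X"
  by (simp add: hereditarily monotonically_normal_space_subtopology
      monotonically_normal_imp_normal_space)

section \<open>Trees and rays\<close>

lemma order_tree_trans:
  assumes "order_tree T r" "(a, b) \<in> r" "(b, c) \<in> r"
  shows "(a, c) \<in> r"
  using assms unfolding order_tree_def partial_order_on_def preorder_on_def by (meson transD)

lemma order_tree_antisym:
  assumes "order_tree T r" "(a, b) \<in> r" "(b, a) \<in> r"
  shows "a = b"
  using assms unfolding order_tree_def partial_order_on_def by (meson antisymD)

lemma order_tree_refl:
  assumes "order_tree T r" "a \<in> T"
  shows "(a, a) \<in> r"
  using assms unfolding order_tree_def partial_order_on_def preorder_on_def by (meson refl_onD)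

lemma order_tree_in_carrier:
  assumes "order_tree T r" "(a, b) \<in> r"
  shows "a \<in> T" "b \<in> T"
  using assms unfolding order_tree_def partial_order_on_def preorder_on_def by auto

lemma order_tree_below_total:
  assumes tree: "order_tree T r" and "(a, t) \<in> r" "(b, t) \<in> r"
  shows "(a, b) \<in> r \<or> (b, a) \<in> r"
proof (cases "a = t \<or> b = t \<or> a = b")
  case True
  then show ?thesis
    using assms order_tree_refl[OF tree] order_tree_in_carrier[OF tree] by blast
next
  case False
  then have "a \<in> underS r t" "b \<in> underS r t" "t \<in> T"
    using assms order_tree_in_carrier[OF tree] by (auto simp: underS_def)
  moreover from this have "total_on (underS r t) (r \<inter> underS r t \<times> underS r t)"
    using tree by (auto simp: order_tree_def well_order_on_def linear_order_on_def)
  ultimately show ?thesis using False by (auto simp: total_on_def)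
qed

lemma order_tree_underS_least:
  assumes tree: "order_tree T r" and "t \<in> T" "A \<subseteq> underS r t" "A \<noteq> {}"
  obtains g where "g \<in> A" "\<And>s. s \<in> underS r g \<Longrightarrow> s \<notin> A"
proof -
  have "wf (r \<inter> underS r t \<times> underS r t - Id)"
    using assms by (auto simp: order_tree_def well_order_on_def)
  then obtain g where g: "g \<in> A" and least: "\<And>s. (s, g) \<in> r \<inter> underS r t \<times> underS r t - Id \<Longrightarrow> s \<notin> A"
    using \<open>A \<noteq> {}\<close> by (metis wf_eq_minimal ex_in_conv)
  have "s \<notin> A" if "s \<in> underS r g" for s
    using least[of s] that g \<open>A \<subseteq> underS r t\<close> by (auto simp: underS_def)
  with g that show ?thesis by blast
qed

lemma tree_ray_subset: "tree_ray T r x \<Longrightarrow> x \<subseteq> T"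
  by (simp add: tree_ray_def tree_path_def)

lemma tree_ray_nonempty: "tree_ray T r x \<Longrightarrow> x \<noteq> {}"
  by (simp add: tree_ray_def tree_path_def)

lemma tree_ray_total: "\<lbrakk>tree_ray T r x; a \<in> x; b \<in> x\<rbrakk> \<Longrightarrow> (a, b) \<in> r \<or> (b, a) \<in> r"
  by (auto simp: tree_ray_def tree_path_def Chains_def)

lemma tree_ray_down_closed:
  "\<lbrakk>order_tree T r; tree_ray T r x; b \<in> x; (a, b) \<in> r\<rbrakk> \<Longrightarrow> a \<in> x"
  using order_tree_in_carrier(1) by (fastforce simp: tree_ray_def tree_path_def)

text \<open>For a ray of a tree these are its minimal upper bounds. A ray may have several, even
  infinitely many, when the tree is not Hausdorff.\<close>

definition tops :: "'a set \<Rightarrow> 'a rel \<Rightarrow> 'a set \<Rightarrow> 'a set"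
  where "tops T r x = {g \<in> T. underS r g = x}"

lemma top_below_upper_bound:
  assumes tree: "order_tree T r" and x: "tree_ray T r x"
    and i: "i \<in> T" "i \<notin> x" and ub: "\<And>t. t \<in> x \<Longrightarrow> (t, i) \<in> r"
  obtains g where "g \<in> tops T r x" "(g, i) \<in> r"
proof -
  \<comment> \<open>The least node outside \<open>x\<close> among those up to \<open>i\<close> is
    the candidate: \<open>i\<close> itself if all its strict predecessors are in \<open>x\<close>,
    otherwise a minimal element of \<open>underS r i - x\<close>.\<close>
  obtain g where g: "g \<notin> x" "(g, i) \<in> r" and least: "\<And>s. s \<in> underS r g \<Longrightarrow> s \<in> x"
  proof (cases "underS r i \<subseteq> x")
    case True
    then show ?thesis using that[of i] i order_tree_refl[OF tree] by blast
  next
    case False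
    obtain g where "g \<in> underS r i - x" and least: "\<And>s. s \<in> underS r g \<Longrightarrow> s \<notin> underS r i - x"
      using order_tree_underS_least[OF tree i(1), of "underS r i - x"] False by blast
    then have g: "g \<notin> x" "(g, i) \<in> r" "g \<noteq> i" by (auto simp: underS_def)
    have "s \<in> x" if "s \<in> underS r g" for s
      using least[OF that] that g order_tree_trans[OF tree, of s g i] order_tree_antisym[OF tree, of g i]
      by (auto simp: underS_def)
    with g that show ?thesis by blast
  qed
  \<comment> \<open>Both \<open>t\<close> and \<open>g\<close> lie below \<open>i\<close>, hence are
    comparable; \<open>g\<close> below \<open>t\<close> would put \<open>g\<close> into the
    down-closed set \<open>x\<close>.\<close>
  have "t \<in> underS r g" if "t \<in> x" for t
    using order_tree_below_total[OF tree ub[OF that] g(2)] g(1) that tree_ray_down_closed[OF tree x]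
    by (auto simp: underS_def)
  then have "g \<in> tops T r x"
    using least order_tree_in_carrier[OF tree g(2)] by (auto simp: tops_def)
  with g(2) that show ?thesis by blast
qed

section \<open>Basic open sets of the ray space\<close>

text \<open>The set \<open>[t; F]\<close>, as characteristic functions. One required node is enough:
  finitely many nodes of a ray have a largest one, and rays are down-closed.\<close>

definition ray_box :: "'a set \<Rightarrow> 'a rel \<Rightarrow> 'a \<Rightarrow> 'a set \<Rightarrow> ('a \<Rightarrow> bool) set"
  where "ray_box T r t F = char_fun T ` {p. tree_ray T r p \<and> t \<in> p \<and> F \<inter> p = {}}"

lemma char_fun_inject:
  assumes "x \<subseteq> T" "y \<subseteq> T"
  shows "char_fun T x = char_fun T y \<longleftrightarrow> x = y"
proof
  assume "char_fun T x = char_fun T y"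
  then have "t \<in> x \<longleftrightarrow> t \<in> y" if "t \<in> T" for t
    using that by (auto simp: char_fun_def dest: fun_cong[where x = t])
  then show "x = y" using assms by blast
qed simp

lemma char_fun_in_ray_box:
  assumes "tree_ray T r x"
  shows "char_fun T x \<in> ray_box T r t F \<longleftrightarrow> t \<in> x \<and> F \<inter> x = {}"
  using assms char_fun_inject[OF tree_ray_subset tree_ray_subset]
  unfolding ray_box_def image_iff mem_Collect_eq by blast

lemma topspace_ray_space: "topspace (ray_space T r) = char_fun T ` {p. tree_ray T r p}"
  by (auto simp: ray_space_def char_fun_def)

lemma openin_ray_space_coordinate:
  assumes "t \<in> T"
  shows "openin (ray_space T r) {f \<in> topspace (ray_space T r). f t \<in> S}"
proof (rule openin_continuous_map_preimage)
  show "continuous_map (ray_space T r) (discrete_topology UNIV) (\<lambda>f. f t)"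
    unfolding ray_space_def using assms
    by (intro continuous_map_from_subtopology continuous_map_product_projection)
qed simp

lemma openin_ray_box:
  assumes "t \<in> T" "finite F" "F \<subseteq> T"
  shows "openin (ray_space T r) (ray_box T r t F)"
proof -
  let ?X = "ray_space T r"
  have pos: "openin ?X {f \<in> topspace ?X. f s}" and neg: "openin ?X {f \<in> topspace ?X. \<not> f s}"
    if "s \<in> T" for s
    using openin_ray_space_coordinate[OF that, of r "{True}"]
      openin_ray_space_coordinate[OF that, of r "{False}"] by simp_all
  \<comment> \<open>The condition at \<open>t\<close> stands outside the big intersection, so that
    the set stays within the space even for empty \<open>F\<close>.\<close>
  have "openin ?X ({f \<in> topspace ?X. f t} \<inter> \<Inter>((\<lambda>s. {f \<in> topspace ?X. \<not> f s}) ` F))"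
    using pos[OF assms(1)] assms neg by (intro openin_Int_Inter) auto
  also have "{f \<in> topspace ?X. f t} \<inter> \<Inter>((\<lambda>s. {f \<in> topspace ?X. \<not> f s}) ` F) = ray_box T r t F"
    using assms unfolding topspace_ray_space ray_box_def by (auto simp: char_fun_def subset_iff)
  finally show ?thesis .
qed

text \<open>If \<open>i\<close> is in \<open>x\<close>, require \<open>i\<close>. If
  \<open>i\<close> lies above all of \<open>x\<close>, forbid a top of \<open>x\<close> below
  \<open>i\<close>. Otherwise require a node of \<open>x\<close> that is not below
  \<open>i\<close>.\<close>

lemma ray_box_deciding_node:
  assumes tree: "order_tree T r" and x: "tree_ray T r x" and i: "i \<in> T"
  obtains t F where "t \<in> x" "finite F" "F \<subseteq> tops T r x"
    "\<And>y. \<lbrakk>tree_ray T r y; t \<in> y; F \<inter> y = {}\<rbrakk> \<Longrightarrow> i \<in> y \<longleftrightarrow> i \<in> x"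
proof (cases "i \<in> x")
  case True
  then show ?thesis using that[of i "{}"] by simp
next
  case False
  show ?thesis
  proof (cases "\<forall>t\<in>x. (t, i) \<in> r")
    case True
    then obtain g where g: "g \<in> tops T r x" "(g, i) \<in> r"
      using top_below_upper_bound[OF tree x i False] by blast
    obtain t where "t \<in> x" using tree_ray_nonempty[OF x] by blast
    then show ?thesis
      using that[of t "{g}"] g False tree_ray_down_closed[OF tree] by blast
  next
    case not_ub: False
    then obtain t where "t \<in> x" "(t, i) \<notin> r" by blast
    \<comment> \<open>A ray through both \<open>t\<close> and \<open>i\<close> would force
      \<open>i\<close> below \<open>t\<close>, hence into \<open>x\<close>.\<close>
    have "i \<notin> y" if "tree_ray T r y" "t \<in> y" for y
      using tree_ray_total[OF that] \<open>(t, i) \<notin> r\<close> tree_ray_down_closed[OF tree x \<open>t \<in> x\<close>] False by blast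
    then show ?thesis using that[of t "{}"] \<open>t \<in> x\<close> False by simp
  qed
qed

text \<open>Boxes around the same ray can be intersected: take the larger of the two required nodes
  and the union of the forbidden sets.\<close>

lemma ray_box_deciding_finite:
  assumes tree: "order_tree T r" and x: "tree_ray T r x" and "finite I" "I \<subseteq> T"
  shows "\<exists>t F. t \<in> x \<and> finite F \<and> F \<subseteq> tops T r x \<and>
    (\<forall>y. tree_ray T r y \<and> t \<in> y \<and> F \<inter> y = {} \<longrightarrow> I \<inter> y = I \<inter> x)"
  using assms(3,4)
proof (induction I rule: finite_induct)
  case empty
  obtain t where "t \<in> x" using tree_ray_nonempty[OF x] by blast
  then show ?case by blast
next
  case (insert i I)
  then obtain t F where tF: "t \<in> x" "finite F" "F \<subseteq> tops T r x"
    "\<And>y. \<lbrakk>tree_ray T r y; t \<in> y; F \<inter> y = {}\<rbrakk> \<Longrightarrow> I \<inter> y = I \<inter> x" by auto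
  obtain s G where sG: "s \<in> x" "finite G" "G \<subseteq> tops T r x"
    "\<And>y. \<lbrakk>tree_ray T r y; s \<in> y; G \<inter> y = {}\<rbrakk> \<Longrightarrow> i \<in> y \<longleftrightarrow> i \<in> x"
    using ray_box_deciding_node[OF tree x] insert.prems by blast
  obtain u where u: "u \<in> x" "(t, u) \<in> r" "(s, u) \<in> r"
    using tree_ray_total[OF x tF(1) sG(1)] tF(1) sG(1) tree_ray_subset[OF x] order_tree_refl[OF tree]
    by blast
  have "insert i I \<inter> y = insert i I \<inter> x"
    if y: "tree_ray T r y" "u \<in> y" "(F \<union> G) \<inter> y = {}" for y
  proof -
    have "t \<in> y" "s \<in> y" using tree_ray_down_closed[OF tree y(1,2)] u by blast+
    then show ?thesis using tF(4)[of y] sG(4)[of y] y by blast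
  qed
  moreover have "finite (F \<union> G)" "F \<union> G \<subseteq> tops T r x" using tF sG by auto
  ultimately show ?case using u(1) by blast
qed

text \<open>A basic open set of the product restricts only finitely many coordinates, and some box
  around \<open>x\<close> makes all its rays agree with \<open>x\<close> there.\<close>

lemma ray_box_neighbourhood:
  assumes tree: "order_tree T r" and x: "tree_ray T r x"
    and U: "openin (ray_space T r) U" "char_fun T x \<in> U"
  shows "\<exists>t F. t \<in> x \<and> finite F \<and> F \<subseteq> tops T r x \<and> ray_box T r t F \<subseteq> U"
proof -
  obtain W where W: "openin (product_topology (\<lambda>_. discrete_topology (UNIV::bool set)) T) W"
    "U = W \<inter> char_fun T ` {p. tree_ray T r p}"
    using U(1) unfolding ray_space_def openin_subtopology by blast
  then obtain S where S: "finite {i \<in> T. S i \<noteq> (UNIV::bool set)}" "char_fun T x \<in> Pi\<^sub>E T S" "Pi\<^sub>E T S \<subseteq> W"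
    using U(2) unfolding openin_product_topology_alt by fastforce
  obtain t F where tF: "t \<in> x" "finite F" "F \<subseteq> tops T r x"
    "\<And>y. \<lbrakk>tree_ray T r y; t \<in> y; F \<inter> y = {}\<rbrakk>
      \<Longrightarrow> {i \<in> T. S i \<noteq> UNIV} \<inter> y = {i \<in> T. S i \<noteq> UNIV} \<inter> x"
    using ray_box_deciding_finite[OF tree x S(1)] by auto
  have "char_fun T y \<in> U" if y: "tree_ray T r y" "t \<in> y" "F \<inter> y = {}" for y
  proof -
    have "char_fun T y i \<in> S i" if "i \<in> T" for i
    proof (cases "S i = UNIV")
      case False
      then have "i \<in> y \<longleftrightarrow> i \<in> x" using tF(4)[OF y] that by blast
      then have "char_fun T y i = char_fun T x i" by (simp add: char_fun_def)
      with PiE_mem[OF S(2) that] show ?thesis by (simp only:)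
    qed simp
    then have "char_fun T y \<in> Pi\<^sub>E T S" by (auto simp: char_fun_def)
    then show ?thesis using S(3) W(2) y(1) by blast
  qed
  then have "ray_box T r t F \<subseteq> U" by (auto simp: ray_box_def)
  with tF show ?thesis by blast
qed

text \<open>The combinatorial core. The order of \<open>t\<close> and \<open>s\<close> breaks the
  symmetry between the two boxes, and the proof splits on whether \<open>y\<close> contains a
  forbidden top of \<open>x\<close>.\<close>

lemma ray_box_meet:
  assumes tree: "order_tree T r"
    and x: "tree_ray T r x" and y: "tree_ray T r y" and z: "tree_ray T r z"
    and F: "F \<subseteq> tops T r x" "F \<inter> z = {}" and "t \<in> z"
    and s: "s \<in> y" "s \<in> z" and G: "G \<inter> y = {}" and "(t, s) \<in> r"
  shows "(s \<in> x \<and> G \<inter> x = {}) \<or> (t \<in> y \<and> F \<inter> y = {})"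
proof (cases "F \<inter> y = {}")
  case True
  then show ?thesis using tree_ray_down_closed[OF tree y s(1)] \<open>(t, s) \<in> r\<close> by blast
next
  case False
  then obtain f where f: "f \<in> F" "f \<in> y" by blast
  have x_eq: "x = underS r f" using f F by (auto simp: tops_def)
  have "f \<notin> z" using f F by blast
  then have "(f, s) \<notin> r" using tree_ray_down_closed[OF tree z s(2)] by blast
  \<comment> \<open>In \<open>y\<close> the nodes \<open>f\<close> and \<open>s\<close> are
    comparable, so \<open>s\<close> is below \<open>f\<close>; they differ because only
    \<open>s\<close> is in \<open>z\<close>.\<close>
  then have "s \<in> x"
    using tree_ray_total[OF y f(2) s(1)] \<open>f \<notin> z\<close> s(2) by (auto simp: x_eq underS_def)
  moreover have "x \<subseteq> y"
    using tree_ray_down_closed[OF tree y f(2)] by (auto simp: x_eq underS_def)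
  ultimately show ?thesis using G by blast
qed

lemma monotonically_normal_ray_space:
  assumes tree: "order_tree T r"
  shows "monotonically_normal_space (ray_space T r)"
proof -
  let ?X = "ray_space T r"
  have point: "\<exists>x. tree_ray T r x \<and> \<phi> = char_fun T x" if "openin ?X U" "\<phi> \<in> U" for U \<phi>
    using openin_subset[OF that(1)] that(2) by (auto simp: topspace_ray_space)
  have "\<exists>x t F. tree_ray T r x \<and> \<phi> = char_fun T x \<and> t \<in> x \<and> finite F \<and> F \<subseteq> tops T r x \<and>
      ray_box T r t F \<subseteq> U" if "openin ?X U" "\<phi> \<in> U" for U \<phi>
    using point[OF that] ray_box_neighbourhood[OF tree _ that(1)] that(2) by blast
  \<comment> \<open>Choice fixes one box for each pair of an open set \<open>U\<close> and a point
    \<open>\<phi>\<close> of it; \<open>x U \<phi>\<close> is the ray whose characteristic function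
    is \<open>\<phi>\<close>.\<close>
  then obtain x t F where ch: "\<And>U \<phi>. \<lbrakk>openin ?X U; \<phi> \<in> U\<rbrakk> \<Longrightarrow>
      tree_ray T r (x U \<phi>) \<and> \<phi> = char_fun T (x U \<phi>) \<and> t U \<phi> \<in> x U \<phi> \<and> finite (F U \<phi>) \<and>
      F U \<phi> \<subseteq> tops T r (x U \<phi>) \<and> ray_box T r (t U \<phi>) (F U \<phi>) \<subseteq> U"
    by metis
  \<comment> \<open>A top has the ray as its set of strict predecessors and is not a strict
    predecessor of itself.\<close>
  have disj: "F U \<phi> \<inter> x U \<phi> = {}" if "openin ?X U" "\<phi> \<in> U" for U \<phi>
    using ch[OF that] by (auto simp: tops_def underS_def)
  show ?thesis
    unfolding monotonically_normal_space_def
  proof (intro exI[of _ "\<lambda>U \<phi>. ray_box T r (t U \<phi>) (F U \<phi>)"] conjI allI impI; elim conjE)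
    fix U \<phi> assume U: "openin ?X U" "\<phi> \<in> U"
    note c = ch[OF U]
    show "openin ?X (ray_box T r (t U \<phi>) (F U \<phi>))"
      using c tree_ray_subset by (intro openin_ray_box) (auto simp: tops_def)
    show "\<phi> \<in> ray_box T r (t U \<phi>) (F U \<phi>)"
      using c disj[OF U] by (metis char_fun_in_ray_box)
    show "ray_box T r (t U \<phi>) (F U \<phi>) \<subseteq> U" using c by blast
  next
    fix U \<phi> V \<psi>
    assume U: "openin ?X U" "\<phi> \<in> U" and V: "openin ?X V" "\<psi> \<in> V"
      and "ray_box T r (t U \<phi>) (F U \<phi>) \<inter> ray_box T r (t V \<psi>) (F V \<psi>) \<noteq> {}"
    then obtain z where z: "tree_ray T r z"
      "char_fun T z \<in> ray_box T r (t U \<phi>) (F U \<phi>)" "char_fun T z \<in> ray_box T r (t V \<psi>) (F V \<psi>)"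
      by (auto simp: ray_box_def)
    note zU = z(2)[unfolded char_fun_in_ray_box[OF z(1)]]
      and zV = z(3)[unfolded char_fun_in_ray_box[OF z(1)]]
    note cU = ch[OF U] and cV = ch[OF V]
    \<comment> \<open>Both required nodes lie on \<open>z\<close> and are comparable; the two
      possible orders use \<open>ray_box_meet\<close> with the roles of the boxes exchanged.\<close>
    have "(t V \<psi> \<in> x U \<phi> \<and> F V \<psi> \<inter> x U \<phi> = {}) \<or> (t U \<phi> \<in> x V \<psi> \<and> F U \<phi> \<inter> x V \<psi> = {})"
      using tree_ray_total[OF z(1), of "t U \<phi>" "t V \<psi>"]
    proof
      assume "(t U \<phi>, t V \<psi>) \<in> r"
      then show ?thesis
        using ray_box_meet[OF tree _ _ z(1)] cU cV zU zV disj[OF V] by blast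
    next
      assume "(t V \<psi>, t U \<phi>) \<in> r"
      then show ?thesis
        using ray_box_meet[OF tree _ _ z(1)] cU cV zU zV disj[OF U] by blast
    qed (use zU zV in auto)
    then have "\<phi> \<in> ray_box T r (t V \<psi>) (F V \<psi>) \<or> \<psi> \<in> ray_box T r (t U \<phi>) (F U \<phi>)"
      using cU cV by (metis char_fun_in_ray_box)
    then show "\<phi> \<in> V \<or> \<psi> \<in> U" using cU cV by blast
  qed
qed

theorem proposition2p14:
  fixes T :: "'a set" and r :: "'a rel"
  assumes "order_tree T r"
  shows "monotonically_normal_space (ray_space T r) \<and>
    hereditarily normal_space (ray_space T r)"
  using monotonically_normal_ray_space[OF assms] monotonically_normal_imp_hereditarily_normal
  by blast

end
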